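(* Let $\sigma:\mathcal{E}\to\mathbb{R}$ be a sublinear function. Then, for $\lambda\in\mathbb{R}$, $\sigma$ is inner $\lambda$-smoothable if and only if $\lambda\ge w_\sigma$. In particular, for any target smoothness level $\beta>0$, a $\beta$-smooth convex function $f:\mathcal{E}\to\mathbb{R}$ is an optimal inner $\beta$-smoothing of $\sigma$ if and only if $[F^{\mathrm{in}}_\sigma]_{1/\beta}\le f\le[f^{\mathrm{in}}_\sigma]_{1/\beta}$ pointwise on $\mathcal{E}$.
   Context: $\mathcal{E}$ is a finite-dimensional Euclidean space with inner product $\langle\cdot,\cdot\rangle$ and induced norm $\|\cdot\|$. A function $\sigma:\mathcal{E}\to\mathbb{R}$ is sublinear if $\sigma(tx)=t\sigma(x)$ for all $t\ge 0$ and $\sigma(x+y)\le\sigma(x)+\sigma(y)$. A function $f:\mathcal{E}\to\mathbb{R}$ is $\beta$-smooth if it is differentiable with $\|\nabla f(x)-\nabla f(y)\|\le\beta\|x-y\|$ for all $x,y$. For $f,g:\mathcal{E}\to\mathbb{R}$, $\mathrm{dist}(f,g)=\sup_{x}|f(x)-g(x)|$ (possibly $+\infty$), and $f\ge g$ is meant pointwise. For $\eta>0$, $[f]_\eta(x)=\eta f(x/\eta)$. The infimal convolution is $(f\,\square\,g)(x)=\inf_{y}f(y)+g(x-y)$. The epigraph is $\mathrm{epi}\,f=\{(x,\alpha)\in\mathcal{E}\times\mathbb{R}: f(x)\le\alpha\}$, and $\partial\sigma(0)$ is the convex subdifferential of $\sigma$ at $0$. Inner smoothability: $\sigma$ is inner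 $\lambda$-smoothable if for every $\beta>0$ there is a $\beta$-smooth convex $f:\mathcal{E}\to\mathbb{R}$ with $f\ge\sigma$ and $\mathrm{dist}(f,\sigma)\le\lambda/\beta$. A convex $f:\mathcal{E}\to\mathbb{R}$ is an optimal inner $\beta$-smoothing of $\sigma$ if $f$ is $\beta$-smooth, $f\ge\sigma$, and $\mathrm{dist}(\sigma,f)\le\mathrm{dist}(\sigma,\tilde f)$ for all $\beta$-smooth convex $\tilde f:\mathcal{E}\to\mathbb{R}$ with $\tilde f\ge\sigma$. Core, center, width: $C_\sigma=\{(x,r)\in\mathcal{E}\times\mathbb{R}: (x,r)+\mathrm{epi}\,\tfrac12\|\cdot\|^2\subseteq\mathrm{epi}\,\sigma\}$; $(x_\sigma,r_\sigma)$ is the (unique) minimizer of $r+\tfrac12\|x\|^2$ over $(x,r)\in C_\sigma$; $w_\sigma=r_\sigma+\tfrac12\|x_\sigma\|^2$; and $\varrho_\sigma(x)=\max_{\zeta\in\partial\sigma(0)}\langle\zeta,x\rangle+\tfrac12\|\zeta\|^2$. Extremal smoothings: $f^{\mathrm{in}}_\sigma=(r_\sigma+\sigma(\cdot-x_\sigma))\,\square\,\tfrac12\|\cdot\|^2$ and $F^{\mathrm{in}}_\sigma=\varrho_\sigma\,\square\,\tfrac12\|\cdot\|^2$. *)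

theory Defs
  imports "HOL-Analysis.Analysis"
begin

definition sublinear :: "('a::euclidean_space \<Rightarrow> real) \<Rightarrow> bool" where
  "sublinear \<sigma> \<longleftrightarrow>
     (\<forall>t\<ge>0. \<forall>x. \<sigma> (t *\<^sub>R x) = t * \<sigma> x) \<and> (\<forall>x y. \<sigma> (x + y) \<le> \<sigma> x + \<sigma> y)"

definition smooth_fun :: "real \<Rightarrow> ('a::euclidean_space \<Rightarrow> real) \<Rightarrow> bool" where
  "smooth_fun \<beta> f \<longleftrightarrow>
     (\<exists>df. (\<forall>x. GDERIV f x :> df x) \<and> (\<forall>x y. norm (df x - df y) \<le> \<beta> * norm (x - y)))"

text \<open>Extended-real valued, since the supremum may be infinite.\<close>
definition sup_dist :: "('a \<Rightarrow> real) \<Rightarrow> ('a \<Rightarrow> real) \<Rightarrow> ereal" where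
  "sup_dist f g = (SUP x. ereal \<bar>f x - g x\<bar>)"

definition rescale :: "real \<Rightarrow> ('a::real_vector \<Rightarrow> real) \<Rightarrow> 'a \<Rightarrow> real" where
  "rescale \<eta> f x = \<eta> * f (x /\<^sub>R \<eta>)"

text \<open>The infimum is taken in \<^typ>\<open>real\<close>, hence meaningful only if
  \<open>y \<mapsto> f y + g (x - y)\<close> is bounded below. This holds wherever it is used here: \<open>g\<close> is half
  the squared norm, and \<open>f\<close> is bounded below by an affine function.\<close>
definition inf_conv :: "('a::ab_group_add \<Rightarrow> real) \<Rightarrow> ('a \<Rightarrow> real) \<Rightarrow> 'a \<Rightarrow> real" where
  "inf_conv f g x = (INF y. f y + g (x - y))"

definition subdiff :: "('a::real_inner \<Rightarrow> real) \<Rightarrow> 'a \<Rightarrow> 'a set" where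
  "subdiff f x = {\<zeta>. \<forall>y. f x + \<zeta> \<bullet> (y - x) \<le> f y}"

definition half_sq :: "'a::real_normed_vector \<Rightarrow> real" where
  "half_sq x = (norm x)\<^sup>2 / 2"

definition inner_smoothable :: "real \<Rightarrow> ('a::euclidean_space \<Rightarrow> real) \<Rightarrow> bool" where
  "inner_smoothable l \<sigma> \<longleftrightarrow>
     (\<forall>\<beta>>0. \<exists>f. smooth_fun \<beta> f \<and> convex_on UNIV f \<and> (\<forall>x. \<sigma> x \<le> f x) \<and>
        sup_dist f \<sigma> \<le> ereal (l / \<beta>))"

definition optimal_inner_smoothing ::
    "real \<Rightarrow> ('a::euclidean_space \<Rightarrow> real) \<Rightarrow> ('a \<Rightarrow> real) \<Rightarrow> bool" where
  "optimal_inner_smoothing \<beta> \<sigma> f \<longleftrightarrow>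
     convex_on UNIV f \<and> smooth_fun \<beta> f \<and> (\<forall>x. \<sigma> x \<le> f x) \<and>
     (\<forall>g. smooth_fun \<beta> g \<and> convex_on UNIV g \<and> (\<forall>x. \<sigma> x \<le> g x) \<longrightarrow>
        sup_dist \<sigma> f \<le> sup_dist \<sigma> g)"

definition core :: "('a::euclidean_space \<Rightarrow> real) \<Rightarrow> ('a \<times> real) set" where
  "core \<sigma> = {p. (\<lambda>q. p + q) ` epigraph UNIV half_sq \<subseteq> epigraph UNIV \<sigma>}"

text \<open>For sublinear \<open>\<sigma>\<close>, \<open>(x, r)\<close> lies in the core iff \<open>r\<close> is at least the finite convex
  function \<open>x \<mapsto> SUP y. \<sigma> (x + y) - half_sq y\<close> at \<open>x\<close>. Minimizing \<open>r + half_sq x\<close> over the core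
  is therefore a strongly convex problem, and the minimizer exists and is unique.\<close>
definition center :: "('a::euclidean_space \<Rightarrow> real) \<Rightarrow> 'a \<times> real" where
  "center \<sigma> = (THE p. is_arg_min (\<lambda>(x, r). r + half_sq x) (\<lambda>p. p \<in> core \<sigma>) p)"

definition width :: "('a::euclidean_space \<Rightarrow> real) \<Rightarrow> real" where
  "width \<sigma> = snd (center \<sigma>) + half_sq (fst (center \<sigma>))"

text \<open>For sublinear \<open>\<sigma>\<close> the set \<open>subdiff \<sigma> 0\<close> is nonempty and compact, so this supremum
  is a maximum.\<close>
definition rho :: "('a::euclidean_space \<Rightarrow> real) \<Rightarrow> 'a \<Rightarrow> real" where
  "rho \<sigma> x = (SUP \<zeta>\<in>subdiff \<sigma> 0. \<zeta> \<bullet> x + half_sq \<zeta>)"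

definition f_in :: "('a::euclidean_space \<Rightarrow> real) \<Rightarrow> 'a \<Rightarrow> real" where
  "f_in \<sigma> = inf_conv (\<lambda>x. snd (center \<sigma>) + \<sigma> (x - fst (center \<sigma>))) half_sq"

definition F_in :: "('a::euclidean_space \<Rightarrow> real) \<Rightarrow> 'a \<Rightarrow> real" where
  "F_in \<sigma> = inf_conv (rho \<sigma>) half_sq"

end

theory Submission
  imports Defs
begin

text \<open>
  A positive scaling turns \<open>\<beta>\<close>-smooth majorants of \<open>\<sigma>\<close> into \<open>1\<close>-smooth ones and multiplies their
  distance to \<open>\<sigma>\<close> by \<open>\<beta>\<close>, because \<open>\<sigma>\<close> is its own rescaling. So everything is decided at
  \<open>\<beta> = 1\<close>, where the bridge between smoothings and the core is the descent inequality
  \<open>f (x + y) \<le> f x + g \<bullet> y + half_sq y\<close> with \<open>g\<close> the gradient at \<open>x\<close>. Completing the square, its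
  right-hand side is a translate of \<open>half_sq\<close> with apex \<open>(x - g, f x - half_sq g)\<close>; if
  \<open>\<sigma> \<le> f\<close>, this apex is therefore a core point (\<open>core_of_smooth_majorant\<close>).

  Two of the claims are read off from that point. The core is the epigraph of \<open>rho \<sigma>\<close>, so the
  infimal convolution defining \<open>F_in \<sigma> x\<close>, evaluated at \<open>x - g\<close>, is at most \<open>f x\<close>. At \<open>x = 0\<close> the
  quantity minimized over the core has the value \<open>f 0\<close> at the apex, so \<open>width \<sigma> \<le> f 0\<close>, and since
  \<open>\<sigma> 0 = 0\<close> no smoothing is closer to \<open>\<sigma>\<close> than \<open>width \<sigma>\<close>.

  If moreover \<open>f \<le> \<sigma> + width \<sigma>\<close>, then \<open>f 0 = width \<sigma>\<close>, so the apex at \<open>0\<close> is the center of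
  \<open>\<sigma>\<close>, and the descent inequality at \<open>0\<close> puts \<open>f\<close> below the paraboloid translated to the center.
  Convexity together with \<open>f \<le> \<sigma> + width \<sigma>\<close> makes \<open>\<sigma>\<close> dominate the growth of \<open>f\<close>, that is,
  \<open>f (x + v) \<le> f x + \<sigma> v\<close>. Both bounds combined give \<open>f \<le> f_in \<sigma>\<close>
  (\<open>tight_majorant_le_f_in\<close>).

  Finally \<open>f_in \<sigma>\<close> attains the bound: up to a translation it is the Moreau envelope of the support
  function of \<open>subdiff \<sigma> 0\<close>, whose gradient is the projection onto \<open>subdiff \<sigma> 0\<close>, a
  nonexpansive map.
\<close>

section \<open>Smooth convex functions\<close>

lemma half_sq_inner: "half_sq x = (x \<bullet> x) / 2"
  by (simp add: half_sq_def power2_norm_eq_inner)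

lemma half_sq_add: "half_sq (x + y) = half_sq x + x \<bullet> y + half_sq y"
  by (simp add: half_sq_inner inner_add inner_commute field_simps)

lemma half_sq_diff: "half_sq (x - y) = half_sq x - x \<bullet> y + half_sq y"
  by (simp add: half_sq_inner inner_diff inner_commute field_simps)

lemma half_sq_nonneg: "0 \<le> half_sq x"
  by (simp add: half_sq_def)

lemma half_sq_minus [simp]: "half_sq (- x) = half_sq x"
  by (simp add: half_sq_def)

lemma half_sq_zero [simp]: "half_sq 0 = 0"
  by (simp add: half_sq_def)

lemma inner_le_half_sq: "x \<bullet> y \<le> half_sq x + half_sq y"
  using half_sq_nonneg[of "x - y"] by (simp add: half_sq_diff)

text \<open>The difference of the two sides has, along the segment from \<open>x\<close> to \<open>x + y\<close>, the derivative
  \<open>(df (x + t *\<^sub>R y) - df x) \<bullet> y - L * t * norm y ^ 2\<close>, which is nonpositive by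
  Cauchy-Schwarz and the Lipschitz bound.\<close>
lemma smooth_descent:
  fixes f :: "'a::euclidean_space \<Rightarrow> real"
  assumes df: "\<And>x. GDERIV f x :> df x"
    and lip: "\<And>x y. norm (df x - df y) \<le> L * norm (x - y)"
  shows "f (x + y) \<le> f x + df x \<bullet> y + L * half_sq y"
proof -
  define \<phi> where "\<phi> t = f (x + t *\<^sub>R y) - t * (df x \<bullet> y) - L * (t\<^sup>2 * half_sq y)" for t :: real
  have "\<phi> 1 \<le> \<phi> 0"
  proof (rule DERIV_nonpos_imp_nonincreasing[where f = \<phi>])
    fix t :: real assume t: "0 \<le> t" "t \<le> 1"
    have f': "(f has_derivative (\<lambda>h. h \<bullet> df (x + t *\<^sub>R y))) (at (x + t *\<^sub>R y))"
      using df by (simp add: gderiv_def)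
    have "((\<lambda>t. f (x + t *\<^sub>R y)) has_derivative (\<lambda>h. (h *\<^sub>R y) \<bullet> df (x + t *\<^sub>R y))) (at t)"
      by (rule has_derivative_compose[where f = "\<lambda>t. x + t *\<^sub>R y" and g = f, OF _ f'])
        (auto intro!: derivative_eq_intros)
    then have "((\<lambda>t. f (x + t *\<^sub>R y)) has_field_derivative (y \<bullet> df (x + t *\<^sub>R y))) (at t)"
      by (simp add: has_field_derivative_def mult_commute_abs)
    then have "(\<phi> has_field_derivative
        y \<bullet> df (x + t *\<^sub>R y) - df x \<bullet> y - L * (2 * t * half_sq y)) (at t)"
      unfolding \<phi>_def by (auto intro!: derivative_eq_intros)
    moreover have "y \<bullet> df (x + t *\<^sub>R y) - df x \<bullet> y - L * (2 * t * half_sq y) \<le> 0"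
    proof -
      have "(df (x + t *\<^sub>R y) - df x) \<bullet> y \<le> norm (df (x + t *\<^sub>R y) - df x) * norm y"
        by (rule norm_cauchy_schwarz)
      also have "\<dots> \<le> (L * norm ((x + t *\<^sub>R y) - x)) * norm y"
        by (intro mult_right_mono lip) simp
      also have "\<dots> = L * (2 * t * half_sq y)"
        using t by (simp add: half_sq_def power2_eq_square)
      finally show ?thesis
        by (simp add: inner_diff inner_commute)
    qed
    ultimately show "\<exists>d. (\<phi> has_field_derivative d) (at t) \<and> d \<le> 0"
      by blast
  qed simp
  then show ?thesis
    by (simp add: \<phi>_def)
qed

text \<open>A converse of the descent inequality: affine lower and paraboloidal upper bounds that touch at
  \<open>x\<close> leave \<open>G x\<close> as the only candidate for the gradient, and the lower bounds alone give
  convexity.\<close>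
lemma smooth_convexI:
  fixes f :: "'a::euclidean_space \<Rightarrow> real"
  assumes lower: "\<And>x z. f x + G x \<bullet> (z - x) \<le> f z"
    and upper: "\<And>x z. f z \<le> f x + G x \<bullet> (z - x) + half_sq (z - x)"
    and lip: "\<And>x y. norm (G x - G y) \<le> norm (x - y)"
  shows "smooth_fun 1 f" and "convex_on UNIV f"
proof -
  have "GDERIV f x :> G x" for x
    unfolding gderiv_def has_derivative_at
  proof
    show "bounded_linear (\<lambda>h. h \<bullet> G x)"
      by (rule bounded_linear_inner_left)
    have bound: "norm (norm (f (x + h) - f x - h \<bullet> G x) / norm h) \<le> norm h" for h
    proof -
      have "\<bar>f (x + h) - f x - h \<bullet> G x\<bar> \<le> half_sq h"
        using lower[of x "x + h"] upper[of "x + h" x] by (simp add: inner_commute)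
      also have "\<dots> \<le> norm h * norm h"
        by (simp add: half_sq_def power2_eq_square)
      finally show ?thesis
        by (cases "h = 0") (auto simp: divide_simps)
    qed
    have "((\<lambda>h::'a. norm h) \<longlongrightarrow> 0) (at 0)"
      by (rule tendsto_norm_zero) (rule tendsto_ident_at)
    then show "((\<lambda>h. norm (f (x + h) - f x - h \<bullet> G x) / norm h) \<longlongrightarrow> 0) (at 0)"
      by (rule Lim_null_comparison[rotated]) (use bound in auto)
  qed
  then show "smooth_fun 1 f"
    using lip unfolding smooth_fun_def by auto
  show "convex_on UNIV f"
  proof
    fix t :: real and x y :: 'a
    assume t: "0 < t" "t < 1"
    define w where "w = (1 - t) *\<^sub>R x + t *\<^sub>R y"
    have "(1 - t) *\<^sub>R (x - w) + t *\<^sub>R (y - w) = 0"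
      unfolding w_def by (simp add: algebra_simps)
    then have "(1 - t) * (G w \<bullet> (x - w)) + t * (G w \<bullet> (y - w)) = 0"
      by (metis inner_add_right inner_scaleR_right inner_zero_right)
    moreover have "(1 - t) * (f w + G w \<bullet> (x - w)) \<le> (1 - t) * f x"
      "t * (f w + G w \<bullet> (y - w)) \<le> t * f y"
      using t lower by (auto intro!: mult_left_mono)
    ultimately have "f w \<le> (1 - t) * f x + t * f y"
      by (simp add: algebra_simps)
    then show "f ((1 - t) *\<^sub>R x + t *\<^sub>R y) \<le> (1 - t) * f x + t * f y"
      by (simp add: w_def)
  qed simp
qed

lemma smooth_rescale:
  fixes f :: "'a::euclidean_space \<Rightarrow> real"
  assumes "smooth_fun L f" "0 < \<eta>"
  shows "smooth_fun (L / \<eta>) (rescale \<eta> f)"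
proof -
  obtain df where df: "\<And>x. GDERIV f x :> df x"
    and lip: "\<And>x y. norm (df x - df y) \<le> L * norm (x - y)"
    using assms(1) unfolding smooth_fun_def by blast
  have "GDERIV (rescale \<eta> f) x :> df (x /\<^sub>R \<eta>)" for x
  proof -
    have f': "(f has_derivative (\<lambda>h. h \<bullet> df (x /\<^sub>R \<eta>))) (at (x /\<^sub>R \<eta>))"
      using df by (simp add: gderiv_def)
    have "((\<lambda>x. f (x /\<^sub>R \<eta>)) has_derivative (\<lambda>h. (h /\<^sub>R \<eta>) \<bullet> df (x /\<^sub>R \<eta>))) (at x)"
      by (rule has_derivative_compose[where f = "\<lambda>x. x /\<^sub>R \<eta>" and g = f, OF _ f'])
        (auto intro!: derivative_eq_intros)
    then have "((\<lambda>x. \<eta> * f (x /\<^sub>R \<eta>)) has_derivative (\<lambda>h. \<eta> * ((h /\<^sub>R \<eta>) \<bullet> df (x /\<^sub>R \<eta>)))) (at x)"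
      by (rule has_derivative_mult_right)
    moreover have "(\<lambda>h. \<eta> * ((h /\<^sub>R \<eta>) \<bullet> df (x /\<^sub>R \<eta>))) = (\<lambda>h. h \<bullet> df (x /\<^sub>R \<eta>))"
      using assms(2) by (simp add: fun_eq_iff)
    moreover have "rescale \<eta> f = (\<lambda>x. \<eta> * f (x /\<^sub>R \<eta>))"
      by (simp add: rescale_def fun_eq_iff)
    ultimately show ?thesis
      by (simp add: gderiv_def)
  qed
  moreover have "norm (df (x /\<^sub>R \<eta>) - df (y /\<^sub>R \<eta>)) \<le> L / \<eta> * norm (x - y)" for x y
  proof -
    have "norm (df (x /\<^sub>R \<eta>) - df (y /\<^sub>R \<eta>)) \<le> L * norm ((x - y) /\<^sub>R \<eta>)"
      using lip[of "x /\<^sub>R \<eta>" "y /\<^sub>R \<eta>"] by (simp add: scaleR_diff_right)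
    then show ?thesis
      using assms(2) by (simp add: divide_inverse mult_ac)
  qed
  ultimately show ?thesis
    unfolding smooth_fun_def by (intro exI[of _ "\<lambda>x. df (x /\<^sub>R \<eta>)"]) auto
qed

lemma convex_rescale:
  fixes f :: "'a::euclidean_space \<Rightarrow> real"
  assumes "convex_on UNIV f" "0 < \<eta>"
  shows "convex_on UNIV (rescale \<eta> f)"
proof
  fix t :: real and x y :: 'a
  assume t: "0 < t" "t < 1"
  have "f ((1 - t) *\<^sub>R (x /\<^sub>R \<eta>) + t *\<^sub>R (y /\<^sub>R \<eta>)) \<le> (1 - t) * f (x /\<^sub>R \<eta>) + t * f (y /\<^sub>R \<eta>)"
    using assms(1) t by (intro convex_onD) auto
  moreover have "((1 - t) *\<^sub>R x + t *\<^sub>R y) /\<^sub>R \<eta> = (1 - t) *\<^sub>R (x /\<^sub>R \<eta>) + t *\<^sub>R (y /\<^sub>R \<eta>)"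
    by (simp add: algebra_simps)
  ultimately have "\<eta> * f (((1 - t) *\<^sub>R x + t *\<^sub>R y) /\<^sub>R \<eta>)
      \<le> \<eta> * ((1 - t) * f (x /\<^sub>R \<eta>) + t * f (y /\<^sub>R \<eta>))"
    using assms(2) by simp
  then show "rescale \<eta> f ((1 - t) *\<^sub>R x + t *\<^sub>R y) \<le> (1 - t) * rescale \<eta> f x + t * rescale \<eta> f y"
    by (simp add: rescale_def algebra_simps)
qed simp

lemma rescale_inverse_le_iff:
  assumes "0 < \<beta>"
  shows "(\<forall>x. rescale (1 / \<beta>) g x \<le> f x) \<longleftrightarrow> (\<forall>x. g x \<le> rescale \<beta> f x)" (is ?lower)
    and "(\<forall>x. f x \<le> rescale (1 / \<beta>) g x) \<longleftrightarrow> (\<forall>x. rescale \<beta> f x \<le> g x)" (is ?upper)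
proof -
  have surj: "(\<forall>x. P (\<beta> *\<^sub>R x)) \<longleftrightarrow> (\<forall>x. P x)" for P :: "'a \<Rightarrow> bool"
  proof
    assume *: "\<forall>x. P (\<beta> *\<^sub>R x)"
    show "\<forall>x. P x"
    proof
      fix x
      show "P x"
        using *[rule_format, of "x /\<^sub>R \<beta>"] assms by simp
    qed
  qed simp
  show ?lower
    using assms surj[of "\<lambda>x. g x \<le> rescale \<beta> f x"]
    by (simp add: rescale_def divide_simps mult_ac)
  show ?upper
    using assms surj[of "\<lambda>x. rescale \<beta> f x \<le> g x"]
    by (simp add: rescale_def divide_simps mult_ac)
qed

section \<open>Sublinear functions as support functions\<close>

lemma sublinear_scale: "sublinear \<sigma> \<Longrightarrow> 0 \<le> t \<Longrightarrow> \<sigma> (t *\<^sub>R x) = t * \<sigma> x"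
  by (simp add: sublinear_def)

lemma sublinear_add: "sublinear \<sigma> \<Longrightarrow> \<sigma> (x + y) \<le> \<sigma> x + \<sigma> y"
  by (simp add: sublinear_def)

lemma sublinear_zero: "sublinear \<sigma> \<Longrightarrow> \<sigma> 0 = 0"
  using sublinear_scale[of \<sigma> 0 0] by simp

lemma sublinear_convex:
  assumes "sublinear \<sigma>"
  shows "convex_on UNIV \<sigma>"
proof
  fix t :: real and x y :: 'a
  assume "0 < t" "t < 1"
  then show "\<sigma> ((1 - t) *\<^sub>R x + t *\<^sub>R y) \<le> (1 - t) * \<sigma> x + t * \<sigma> y"
    using sublinear_add[OF assms, of "(1 - t) *\<^sub>R x" "t *\<^sub>R y"]
    by (simp add: sublinear_scale[OF assms])
qed simp

lemma sublinear_continuous: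
  assumes "sublinear \<sigma>"
  shows "continuous_on UNIV \<sigma>"
  by (rule convex_on_continuous[OF open_UNIV sublinear_convex[OF assms]])

lemma sublinear_rescale:
  assumes "sublinear \<sigma>" "0 < \<eta>"
  shows "rescale \<eta> \<sigma> = \<sigma>"
  using assms by (simp add: rescale_def fun_eq_iff sublinear_scale)

lemma sublinear_le_norm:
  assumes "sublinear \<sigma>"
  obtains K where "\<And>x. \<sigma> x \<le> K * norm x"
proof -
  have "compact (\<sigma> ` cball 0 1)"
    by (intro compact_continuous_image compact_cball
        continuous_on_subset[OF sublinear_continuous[OF assms]]) simp
  then obtain K where K: "\<And>x. x \<in> cball 0 1 \<Longrightarrow> \<sigma> x \<le> K"
    by (meson bounded_imp_bdd_above bdd_above.E compact_imp_bounded imageI)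
  have "\<sigma> x \<le> K * norm x" for x
  proof (cases "x = 0")
    case False
    then have "\<sigma> x = norm x * \<sigma> (sgn x)"
      using sublinear_scale[OF assms, of "norm x" "sgn x"] by (simp add: sgn_div_norm)
    also have "\<dots> \<le> norm x * K"
      using False by (intro mult_left_mono K) (auto simp: norm_sgn)
    finally show ?thesis
      by (simp add: mult.commute)
  qed (simp add: sublinear_zero[OF assms])
  then show thesis
    by (rule that)
qed

text \<open>Separate the point \<open>(v, f v)\<close> from the strict epigraph. The separating normal \<open>(p, q)\<close> is not
  horizontal, since the strict epigraph projects onto the whole space; hence \<open>q > 0\<close> and
  \<open>- p / q\<close> is a subgradient.\<close>
lemma convex_subdiff_nonempty:
  fixes f :: "'a::euclidean_space \<Rightarrow> real"
  assumes "convex_on UNIV f"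
  obtains \<zeta> where "\<zeta> \<in> subdiff f v"
proof -
  let ?T = "{z. f (fst z) < snd z}"
  have "convex ?T"
  proof (rule convexI)
    fix y z :: "'a \<times> real" and s t :: real
    assume y: "y \<in> ?T" and z: "z \<in> ?T" and st: "0 \<le> s" "0 \<le> t" "s + t = 1"
    have "f (s *\<^sub>R fst y + t *\<^sub>R fst z) \<le> s * f (fst y) + t * f (fst z)"
      using assms st by (auto simp: convex_on_def)
    also have "\<dots> < s * snd y + t * snd z"
    proof (cases "s = 0")
      case True
      then show ?thesis using z st by simp
    next
      case False
      then show ?thesis using y z st
        by (intro add_less_le_mono mult_strict_left_mono mult_left_mono) auto
    qed
    finally show "s *\<^sub>R y + t *\<^sub>R z \<in> ?T"
      by simp
  qed
  moreover have "?T \<noteq> {}"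
    by (auto intro!: exI[of _ "f v + 1"] exI[of _ v])
  ultimately obtain n b where "n \<noteq> 0" and nb: "\<forall>z\<in>{(v, f v)}. n \<bullet> z \<le> b" "\<forall>z\<in>?T. b \<le> n \<bullet> z"
    using separating_hyperplane_sets[of "{(v, f v)}" ?T] by auto
  obtain p q where n: "n = (p, q)"
    by force
  have sep: "p \<bullet> v + q * f v \<le> p \<bullet> x + q * a" if "f x < a" for x a
    using order_trans[OF nb(1)[rule_format] nb(2)[rule_format], of "(v, f v)" "(x, a)"] that
    by (simp add: n)
  have "q \<ge> 0"
    using sep[of v "f v + 1"] by (simp add: algebra_simps)
  moreover have "q \<noteq> 0"
  proof
    assume q: "q = 0"
    have "p \<bullet> v \<le> p \<bullet> (v - p)"
      using sep[of "v - p" "f (v - p) + 1"] q by simp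
    then have "p \<bullet> p \<le> 0"
      by (simp add: inner_diff)
    then have "p = 0"
      using inner_ge_zero[of p] by (simp add: antisym)
    with q n \<open>n \<noteq> 0\<close> show False
      by (simp add: zero_prod_def)
  qed
  ultimately have q: "q > 0"
    by simp
  have "f v + (- p /\<^sub>R q) \<bullet> (x - v) \<le> f x" for x
  proof (rule field_le_epsilon)
    fix e :: real assume "0 < e"
    then have "p \<bullet> v + q * f v \<le> p \<bullet> x + q * (f x + e)"
      by (intro sep) simp
    then show "f v + (- p /\<^sub>R q) \<bullet> (x - v) \<le> f x + e"
      using q by (simp add: inner_diff field_simps)
  qed
  then show thesis
    by (intro that[of "- p /\<^sub>R q"]) (simp add: subdiff_def)
qed

lemma subdiff_zero_iff:
  assumes "sublinear \<sigma>"
  shows "\<zeta> \<in> subdiff \<sigma> 0 \<longleftrightarrow> (\<forall>y. \<zeta> \<bullet> y \<le> \<sigma> y)"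
  by (simp add: subdiff_def sublinear_zero[OF assms])

text \<open>The maximum is attained at a subgradient of \<open>\<sigma>\<close> at \<open>v\<close>: by homogeneity, testing the
  subgradient inequality at \<open>0\<close> and at \<open>2 v\<close> forces equality along the ray through \<open>v\<close>.\<close>
lemma sublinear_attained:
  assumes "sublinear \<sigma>"
  obtains \<zeta> where "\<zeta> \<in> subdiff \<sigma> 0" "\<zeta> \<bullet> v = \<sigma> v"
proof -
  obtain \<zeta> where "\<zeta> \<in> subdiff \<sigma> v"
    using convex_subdiff_nonempty[OF sublinear_convex[OF assms]] by blast
  then have \<zeta>: "\<sigma> v + \<zeta> \<bullet> (y - v) \<le> \<sigma> y" for y
    by (simp add: subdiff_def)
  have "\<zeta> \<bullet> v = \<sigma> v"
    using \<zeta>[of 0] \<zeta>[of "2 *\<^sub>R v"]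
    by (simp add: sublinear_zero[OF assms] sublinear_scale[OF assms] inner_diff)
  moreover have "\<zeta> \<in> subdiff \<sigma> 0"
    using \<zeta> \<open>\<zeta> \<bullet> v = \<sigma> v\<close> by (simp add: subdiff_zero_iff[OF assms] inner_diff)
  ultimately show thesis
    by (rule that[rotated])
qed

lemma subdiff_zero_convex_closed:
  assumes "sublinear \<sigma>"
  shows "convex (subdiff \<sigma> 0)" and "closed (subdiff \<sigma> 0)"
proof -
  have eq: "subdiff \<sigma> 0 = (\<Inter>y. {\<zeta>. y \<bullet> \<zeta> \<le> \<sigma> y})"
    by (auto simp: subdiff_zero_iff[OF assms] inner_commute)
  show "convex (subdiff \<sigma> 0)"
    unfolding eq by (intro convex_INT ballI convex_halfspace_le)
  show "closed (subdiff \<sigma> 0)"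
    unfolding eq by (intro closed_INT ballI closed_halfspace_le)
qed

section \<open>The core and its center\<close>

lemma mem_core:
  "(x, r) \<in> core \<sigma> \<longleftrightarrow> (\<forall>y. \<sigma> (x + y) \<le> r + half_sq y)"
proof
  assume "(x, r) \<in> core \<sigma>"
  then have "(x, r) + (y, half_sq y) \<in> epigraph UNIV \<sigma>" for y
    unfolding core_def mem_Collect_eq by (rule subsetD, intro imageI) (simp add: mem_epigraph)
  then show "\<forall>y. \<sigma> (x + y) \<le> r + half_sq y"
    by (simp add: mem_epigraph)
next
  assume r: "\<forall>y. \<sigma> (x + y) \<le> r + half_sq y"
  have "(x, r) + (y, a) \<in> epigraph UNIV \<sigma>" if "half_sq y \<le> a" for y a
    using r[rule_format, of y] that by (simp add: mem_epigraph)
  then show "(x, r) \<in> core \<sigma>"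
    unfolding core_def by (auto simp: mem_epigraph)
qed

lemma core_nonempty:
  assumes "sublinear \<sigma>"
  shows "core \<sigma> \<noteq> {}"
proof -
  obtain K where K: "\<And>x. \<sigma> x \<le> K * norm x"
    using sublinear_le_norm[OF assms] by blast
  have "\<sigma> y \<le> K\<^sup>2 / 2 + half_sq y" for y
    using K[of y] sum_squares_bound[of K "norm y"] by (simp add: half_sq_def)
  then have "(0, K\<^sup>2 / 2) \<in> core \<sigma>"
    by (simp add: mem_core)
  then show ?thesis
    by blast
qed

text \<open>Evaluating the core condition at \<open>y = \<zeta>\<close> maximizes \<open>\<zeta> \<bullet> y - half_sq y\<close>.\<close>
lemma core_subdiff_bound:
  assumes "sublinear \<sigma>" "(x, r) \<in> core \<sigma>" "\<zeta> \<in> subdiff \<sigma> 0"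
  shows "\<zeta> \<bullet> x + half_sq \<zeta> \<le> r"
proof -
  have "\<zeta> \<bullet> (x + \<zeta>) \<le> \<sigma> (x + \<zeta>)"
    using assms(1,3) by (simp add: subdiff_zero_iff)
  also have "\<dots> \<le> r + half_sq \<zeta>"
    using assms(2) by (simp add: mem_core)
  finally show ?thesis
    by (simp add: half_sq_inner inner_add)
qed

lemma core_closed:
  assumes "sublinear \<sigma>"
  shows "closed (core \<sigma>)"
proof -
  have "core \<sigma> = (\<Inter>y. {p. \<sigma> (fst p + y) \<le> snd p + half_sq y})"
    by (auto simp: mem_core)
  moreover have "closed {p :: 'a \<times> real. \<sigma> (fst p + y) \<le> snd p + half_sq y}" for y
    by (intro closed_Collect_le continuous_intros
        continuous_on_compose2[OF sublinear_continuous[OF assms]]) auto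
  ultimately show ?thesis
    by auto
qed

text \<open>The minimizer exists by compactness: for a fixed \<open>\<zeta> \<in> subdiff \<sigma> 0\<close> the objective dominates
  \<open>half_sq (x + \<zeta>)\<close> on the core, so its sublevel sets are bounded. It is unique because the core is
  midpoint convex and the objective is strongly convex in \<open>x\<close>.\<close>
lemma center_properties:
  assumes "sublinear \<sigma>"
  shows center_in_core: "center \<sigma> \<in> core \<sigma>"
    and width_le: "(x, r) \<in> core \<sigma> \<Longrightarrow> width \<sigma> \<le> r + half_sq x"
    and center_unique: "(x, r) \<in> core \<sigma> \<Longrightarrow> r + half_sq x \<le> width \<sigma> \<Longrightarrow> center \<sigma> = (x, r)"
proof -
  define v where "v = (\<lambda>(x :: 'a, r). r + half_sq x)"
  have v [simp]: "v (x, r) = r + half_sq x" for x r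
    by (simp add: v_def)
  let ?M = "is_arg_min v (\<lambda>p. p \<in> core \<sigma>)"
  obtain x0 r0 where p0: "(x0, r0) \<in> core \<sigma>"
    using core_nonempty[OF assms] by auto
  obtain \<zeta> where \<zeta>: "\<zeta> \<in> subdiff \<sigma> 0"
    using sublinear_attained[OF assms] by blast
  let ?c = "v (x0, r0)"
  let ?S = "{p \<in> core \<sigma>. v p \<le> ?c}"
  have cont: "continuous_on UNIV v"
    unfolding v_def half_sq_inner split_def by (intro continuous_intros) simp
  have "closed ?S"
  proof -
    have "?S = core \<sigma> \<inter> {p. v p \<le> ?c}" by auto
    moreover have "closed {p. v p \<le> ?c}"
      using cont by (intro closed_Collect_le continuous_intros)
    ultimately show ?thesis
      using core_closed[OF assms] by auto
  qed
  define B where "B = norm \<zeta> + sqrt (2 * ?c)"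
  have "?S \<subseteq> cball 0 B \<times> {- B\<^sup>2 / 2..?c}"
  proof
    fix p assume "p \<in> ?S"
    then obtain x r where p: "p = (x, r)" "(x, r) \<in> core \<sigma>" and le: "r + half_sq x \<le> ?c"
      by (cases p) auto
    have "half_sq (x + \<zeta>) \<le> r + half_sq x"
      using core_subdiff_bound[OF assms p(2) \<zeta>] by (simp add: half_sq_add inner_commute)
    with le have le': "half_sq (x + \<zeta>) \<le> ?c"
      by linarith
    then have "norm (x + \<zeta>) \<le> sqrt (2 * ?c)"
      by (intro real_le_rsqrt) (simp add: half_sq_def)
    then have x: "norm x \<le> B"
      using norm_triangle_ineq4[of "x + \<zeta>" \<zeta>] by (simp add: B_def)
    have "\<sigma> (x + - x) \<le> r + half_sq (- x)"
      using p(2) unfolding mem_core by blast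
    then have "- half_sq x \<le> r"
      by (simp add: sublinear_zero[OF assms])
    moreover have "half_sq x \<le> B\<^sup>2 / 2"
      using x by (simp add: half_sq_def power_mono)
    moreover have "r \<le> ?c"
      using le half_sq_nonneg[of x] by linarith
    ultimately show "p \<in> cball 0 B \<times> {- B\<^sup>2 / 2..?c}"
      using x by (simp add: p)
  qed
  then have "bounded ?S"
    by (rule bounded_subset[rotated]) (intro bounded_Times bounded_cball bounded_closed_interval)
  with \<open>closed ?S\<close> have "compact ?S"
    by (simp add: compact_eq_bounded_closed)
  moreover have "?S \<noteq> {}"
    using p0 by auto
  moreover have "continuous_on ?S v"
    using cont by (rule continuous_on_subset) simp
  ultimately have "\<exists>p\<in>?S. \<forall>q\<in>?S. v p \<le> v q"
    by (rule continuous_attains_inf)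
  then obtain p where "p \<in> ?S" and p: "\<forall>q\<in>?S. v p \<le> v q" ..
  have min: "?M p"
    unfolding is_arg_min_def
  proof (intro conjI notI)
    show "p \<in> core \<sigma>"
      using \<open>p \<in> ?S\<close> by simp
    assume "\<exists>q. q \<in> core \<sigma> \<and> v q < v p"
    then obtain q where q: "q \<in> core \<sigma>" "v q < v p"
      by blast
    with \<open>p \<in> ?S\<close> have "q \<in> ?S"
      by simp
    with p have "v p \<le> v q" ..
    with q(2) show False
      by simp
  qed
  have unique: "q = q'" if "?M q" "?M q'" for q q'
  proof -
    obtain x r x' r' where q: "q = (x, r)" "q' = (x', r')"
      by fastforce
    have mem: "(x, r) \<in> core \<sigma>" "(x', r') \<in> core \<sigma>"
      and eq: "r + half_sq x = r' + half_sq x'"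
      and le: "\<And>y s. (y, s) \<in> core \<sigma> \<Longrightarrow> r + half_sq x \<le> s + half_sq y"
      using that unfolding q is_arg_min_def by (force simp: not_less)+
    let ?m = "(1 / 2) *\<^sub>R (x + x')"
    have "(?m, (r + r') / 2) \<in> core \<sigma>"
      unfolding mem_core
    proof
      fix y
      have "?m + y = (1 / 2) *\<^sub>R (x + y) + (1 / 2) *\<^sub>R (x' + y)"
        by (simp add: scaleR_add_right flip: scaleR_add_left)
      then have "\<sigma> (?m + y) \<le> (1 / 2) * \<sigma> (x + y) + (1 / 2) * \<sigma> (x' + y)"
        using sublinear_add[OF assms, of "(1 / 2) *\<^sub>R (x + y)" "(1 / 2) *\<^sub>R (x' + y)"]
        by (simp add: sublinear_scale[OF assms])
      also have "\<dots> \<le> (1 / 2) * (r + half_sq y) + (1 / 2) * (r' + half_sq y)"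
        using mem unfolding mem_core by (intro add_mono mult_left_mono) auto
      finally show "\<sigma> (?m + y) \<le> (r + r') / 2 + half_sq y"
        by (simp add: field_simps)
    qed
    from le[OF this] have "r + half_sq x \<le> (r + r') / 2 + half_sq ?m" .
    moreover have "half_sq ?m = (half_sq x + half_sq x') / 2 - half_sq (x - x') / 4"
      by (simp add: half_sq_inner inner_add inner_diff inner_commute field_simps)
    ultimately have "half_sq (x - x') \<le> 0"
      using eq by argo
    then have "x = x'"
      by (simp add: half_sq_def)
    with eq q show ?thesis
      by simp
  qed
  have "center \<sigma> = p"
    unfolding center_def v_def[symmetric] using min unique by (intro the_equality) auto
  with min have C: "?M (center \<sigma>)"
    by simp
  then show "center \<sigma> \<in> core \<sigma>"
    by (simp add: is_arg_min_def)
  have width: "width \<sigma> = v (center \<sigma>)"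
    by (simp add: width_def v_def split_def)
  show le: "width \<sigma> \<le> r + half_sq x" if "(x, r) \<in> core \<sigma>" for x r
    using C that unfolding width is_arg_min_def by (force simp: not_less)
  show "center \<sigma> = (x, r)" if "(x, r) \<in> core \<sigma>" "r + half_sq x \<le> width \<sigma>" for x r
  proof (rule unique[OF C])
    show "?M (x, r)"
      using that(1) order_trans[OF that(2) le] unfolding is_arg_min_def by (auto simp: not_less)
  qed
qed

text \<open>The core is the epigraph of \<open>rho \<sigma>\<close>: exchange the two maxima in
  \<open>\<sigma> (x + y) - half_sq y\<close>, over \<open>y\<close> and over the subgradients representing \<open>\<sigma>\<close>.\<close>
lemma core_iff_rho:
  assumes "sublinear \<sigma>"
  shows "(x, r) \<in> core \<sigma> \<longleftrightarrow> rho \<sigma> x \<le> r"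
proof
  assume "(x, r) \<in> core \<sigma>"
  moreover have "subdiff \<sigma> 0 \<noteq> {}"
    using sublinear_attained[OF assms] by blast
  ultimately show "rho \<sigma> x \<le> r"
    unfolding rho_def by (intro cSUP_least) (auto intro: core_subdiff_bound[OF assms])
next
  assume r: "rho \<sigma> x \<le> r"
  obtain x0 r0 where p0: "(x0, r0) \<in> core \<sigma>"
    using core_nonempty[OF assms] by auto
  \<comment> \<open>Translating a core point by \<open>h\<close> costs at most \<open>\<sigma> h\<close>, so the core projects onto the whole
    space; this bounds the supremum.\<close>
  have "(x, r0 + \<sigma> (x - x0)) \<in> core \<sigma>"
    unfolding mem_core
  proof
    fix y
    have "\<sigma> (x + y) \<le> \<sigma> (x0 + y) + \<sigma> (x - x0)"
      using sublinear_add[OF assms, of "x0 + y" "x - x0"] by (simp add: algebra_simps)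
    also have "\<sigma> (x0 + y) \<le> r0 + half_sq y"
      using p0 by (simp add: mem_core)
    finally show "\<sigma> (x + y) \<le> r0 + \<sigma> (x - x0) + half_sq y"
      by simp
  qed
  then have bdd: "bdd_above ((\<lambda>\<zeta>. \<zeta> \<bullet> x + half_sq \<zeta>) ` subdiff \<sigma> 0)"
    by (intro bdd_aboveI2) (rule core_subdiff_bound[OF assms])
  show "(x, r) \<in> core \<sigma>"
    unfolding mem_core
  proof
    fix y
    obtain \<zeta> where \<zeta>: "\<zeta> \<in> subdiff \<sigma> 0" and eq: "\<zeta> \<bullet> (x + y) = \<sigma> (x + y)"
      using sublinear_attained[OF assms] by blast
    have "\<zeta> \<bullet> x + half_sq \<zeta> \<le> rho \<sigma> x"
      unfolding rho_def by (rule cSUP_upper[OF \<zeta> bdd])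
    then show "\<sigma> (x + y) \<le> r + half_sq y"
      using r eq inner_le_half_sq[of \<zeta> y] by (simp add: inner_add)
  qed
qed

lemma sigma_le_core:
  assumes "(y, r) \<in> core \<sigma>"
  shows "\<sigma> x \<le> r + half_sq (x - y)"
  using assms[unfolded mem_core, rule_format, of "x - y"] by simp

lemma sigma_le_rho:
  assumes "sublinear \<sigma>"
  shows "\<sigma> x \<le> rho \<sigma> y + half_sq (x - y)"
  by (rule sigma_le_core) (simp add: core_iff_rho[OF assms])

section \<open>The extremal smoothings\<close>

lemma F_in_le:
  assumes "sublinear \<sigma>"
  shows "F_in \<sigma> x \<le> rho \<sigma> y + half_sq (x - y)"
  unfolding F_in_def inf_conv_def
  by (intro cINF_lower bdd_belowI2[where m = "\<sigma> x"] sigma_le_rho[OF assms]) simp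

lemma sigma_le_F_in:
  assumes "sublinear \<sigma>"
  shows "\<sigma> x \<le> F_in \<sigma> x"
  unfolding F_in_def inf_conv_def by (intro cINF_greatest sigma_le_rho[OF assms]) simp

text \<open>The infimum behind \<open>f_in\<close> is at least \<open>\<sigma>\<close> because the translate of \<open>epigraph UNIV half_sq\<close> to the
  center stays inside the epigraph of \<open>\<sigma>\<close>, and so do all further translates by vectors of that
  epigraph, which is a convex cone.\<close>
lemma sigma_le_f_in_term:
  assumes "sublinear \<sigma>"
  shows "\<sigma> x \<le> snd (center \<sigma>) + \<sigma> (y - fst (center \<sigma>)) + half_sq (x - y)"
proof -
  have "\<sigma> (x - (y - fst (center \<sigma>))) \<le>
      snd (center \<sigma>) + half_sq (x - (y - fst (center \<sigma>)) - fst (center \<sigma>))"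
    by (rule sigma_le_core) (simp add: center_in_core[OF assms])
  moreover have "\<sigma> x \<le> \<sigma> (x - (y - fst (center \<sigma>))) + \<sigma> (y - fst (center \<sigma>))"
    using sublinear_add[OF assms, of "x - (y - fst (center \<sigma>))" "y - fst (center \<sigma>)"] by simp
  moreover have "x - (y - fst (center \<sigma>)) - fst (center \<sigma>) = x - y"
    by simp
  ultimately show ?thesis
    by simp
qed

lemma f_in_le:
  assumes "sublinear \<sigma>"
  shows "f_in \<sigma> x \<le> snd (center \<sigma>) + \<sigma> (y - fst (center \<sigma>)) + half_sq (x - y)"
  unfolding f_in_def inf_conv_def
  by (intro cINF_lower[where f = "\<lambda>y. snd (center \<sigma>) + \<sigma> (y - fst (center \<sigma>)) + half_sq (x - y)"]
      bdd_belowI2[where m = "\<sigma> x"] sigma_le_f_in_term[OF assms]) simp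

lemma f_in_greatest:
  assumes "\<And>y. c \<le> snd (center \<sigma>) + \<sigma> (y - fst (center \<sigma>)) + half_sq (x - y)"
  shows "c \<le> f_in \<sigma> x"
  unfolding f_in_def inf_conv_def using assms by (intro cINF_greatest) auto

text \<open>Taking \<open>y = x + fst (center \<sigma>)\<close> in the infimum shows the gap to be at most the width.\<close>
lemma f_in_bounds:
  assumes "sublinear \<sigma>"
  shows "\<sigma> x \<le> f_in \<sigma> x" and "f_in \<sigma> x \<le> \<sigma> x + width \<sigma>"
proof -
  show "\<sigma> x \<le> f_in \<sigma> x"
    by (intro f_in_greatest sigma_le_f_in_term[OF assms])
  show "f_in \<sigma> x \<le> \<sigma> x + width \<sigma>"
    using f_in_le[OF assms, of x "x + fst (center \<sigma>)"] by (simp add: width_def)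
qed

text \<open>Each \<open>\<zeta>\<close> in \<open>subdiff \<sigma> 0\<close> contributes a lower bound, by replacing \<open>\<sigma>\<close> with the linear form
  \<open>\<zeta>\<close> in the infimum.\<close>
lemma f_in_dual_lower:
  assumes "sublinear \<sigma>" "\<zeta> \<in> subdiff \<sigma> 0"
  shows "snd (center \<sigma>) + \<zeta> \<bullet> (x - fst (center \<sigma>)) - half_sq \<zeta> \<le> f_in \<sigma> x"
proof (rule f_in_greatest)
  fix y
  have "\<zeta> \<bullet> (y - fst (center \<sigma>)) \<le> \<sigma> (y - fst (center \<sigma>))"
    using assms by (simp add: subdiff_zero_iff)
  then show "snd (center \<sigma>) + \<zeta> \<bullet> (x - fst (center \<sigma>)) - half_sq \<zeta>
      \<le> snd (center \<sigma>) + \<sigma> (y - fst (center \<sigma>)) + half_sq (x - y)"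
    using inner_le_half_sq[of \<zeta> "x - y"] by (simp add: inner_diff)
qed

text \<open>Write \<open>\<zeta>\<close> for the projection of \<open>u = x - fst (center \<sigma>)\<close> onto \<open>subdiff \<sigma> 0\<close>. The
  variational inequality of the projection says that \<open>\<zeta>\<close> maximizes \<open>\<xi> \<bullet> (u - \<zeta>)\<close> over
  \<open>subdiff \<sigma> 0\<close>, so \<open>\<sigma> (u - \<zeta>) = \<zeta> \<bullet> (u - \<zeta>)\<close>. This makes \<open>y = x - \<zeta>\<close> a minimizer in the infimal
  convolution, and \<open>\<zeta>\<close> optimal among the lower bounds.\<close>
lemma f_in_smooth_convex:
  assumes "sublinear \<sigma>"
  shows "smooth_fun 1 (f_in \<sigma>)" and "convex_on UNIV (f_in \<sigma>)"
proof -
  let ?Z = "subdiff \<sigma> 0" and ?c = "fst (center \<sigma>)" and ?r = "snd (center \<sigma>)"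
  define G where "G x = closest_point ?Z (x - ?c)" for x
  note Z = subdiff_zero_convex_closed[OF assms]
  have ne: "?Z \<noteq> {}"
    using sublinear_attained[OF assms] by blast
  have G_in: "G x \<in> ?Z" for x
    unfolding G_def by (rule closest_point_in_set[OF Z(2) ne])
  have attained: "\<sigma> (x - G x - ?c) \<le> G x \<bullet> (x - G x - ?c)" for x
  proof -
    obtain \<xi> where \<xi>: "\<xi> \<in> ?Z" "\<xi> \<bullet> (x - G x - ?c) = \<sigma> (x - G x - ?c)"
      using sublinear_attained[OF assms] by blast
    have "(x - ?c - G x) \<bullet> (\<xi> - G x) \<le> 0"
      unfolding G_def by (rule closest_point_dot[OF Z \<xi>(1)])
    then show ?thesis
      using \<xi>(2) by (simp add: inner_diff inner_commute)
  qed
  have upper: "f_in \<sigma> z \<le> ?r + G x \<bullet> (x - G x - ?c) + half_sq (z - x + G x)" for x z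
    using f_in_le[OF assms, of z "x - G x"] attained[of x] by (simp add: algebra_simps)
  have eq: "f_in \<sigma> x = ?r + G x \<bullet> (x - ?c) - half_sq (G x)" for x
    using upper[of x x] f_in_dual_lower[OF assms G_in, of x x]
    by (simp add: inner_diff half_sq_inner)
  have 1: "f_in \<sigma> x + G x \<bullet> (z - x) \<le> f_in \<sigma> z" for x z
    using f_in_dual_lower[OF assms G_in, of x z] by (simp add: eq[of x] inner_diff)
  have 2: "f_in \<sigma> z \<le> f_in \<sigma> x + G x \<bullet> (z - x) + half_sq (z - x)" for x z
    using upper[of z x] unfolding eq[of x] half_sq_add
    by (simp add: inner_diff inner_commute half_sq_inner)
  have 3: "norm (G x - G y) \<le> norm (x - y)" for x y
    using closest_point_lipschitz[OF Z ne, of "x - ?c" "y - ?c"] by (simp add: G_def dist_norm)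
  show "smooth_fun 1 (f_in \<sigma>)" "convex_on UNIV (f_in \<sigma>)"
    using smooth_convexI[of "f_in \<sigma>" G] 1 2 3 by blast+
qed

section \<open>Smooth majorants of a sublinear function\<close>

text \<open>The paraboloid of the descent inequality at \<open>x\<close> lies above \<open>\<sigma>\<close>, and its apex is the point
  claimed.\<close>
lemma core_of_smooth_majorant:
  fixes f :: "'a::euclidean_space \<Rightarrow> real"
  assumes "\<And>x. GDERIV f x :> df x" "\<And>x y. norm (df x - df y) \<le> norm (x - y)"
    and "\<And>x. \<sigma> x \<le> f x"
  shows "(x - df x, f x - half_sq (df x)) \<in> core \<sigma>"
  unfolding mem_core
proof
  fix y
  have "\<sigma> (x - df x + y) \<le> f (x + (y - df x))"
    using assms(3)[of "x + (y - df x)"] by (simp add: algebra_simps)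
  also have "\<dots> \<le> f x + df x \<bullet> (y - df x) + half_sq (y - df x)"
    using smooth_descent[of f df 1 x "y - df x"] assms(1,2) by simp
  also have "\<dots> = f x - half_sq (df x) + half_sq y"
    by (simp add: half_sq_inner inner_diff inner_commute field_simps)
  finally show "\<sigma> (x - df x + y) \<le> f x - half_sq (df x) + half_sq y" .
qed

lemma smooth_majorant_bounds:
  fixes f :: "'a::euclidean_space \<Rightarrow> real"
  assumes "sublinear \<sigma>" "smooth_fun 1 f" "\<And>x. \<sigma> x \<le> f x"
  shows "F_in \<sigma> x \<le> f x" and "width \<sigma> \<le> f 0"
proof -
  obtain df where df: "\<And>x. GDERIV f x :> df x" "\<And>x y. norm (df x - df y) \<le> norm (x - y)"
    using assms(2) unfolding smooth_fun_def by auto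
  note core = core_of_smooth_majorant[OF df assms(3)]
  have "F_in \<sigma> x \<le> rho \<sigma> (x - df x) + half_sq (df x)"
    using F_in_le[OF assms(1), of x "x - df x"] by simp
  also have "\<dots> \<le> f x"
    using core[of x] by (simp add: core_iff_rho[OF assms(1)])
  finally show "F_in \<sigma> x \<le> f x" .
  show "width \<sigma> \<le> f 0"
    using width_le[OF assms(1) core[of 0]] by simp
qed

text \<open>The slope of a convex function in direction \<open>v\<close> is at most its asymptotic slope, and that is
  at most \<open>\<sigma> v\<close> when \<open>f - \<sigma>\<close> is bounded above.\<close>
lemma convex_growth_le_sublinear:
  fixes f :: "'a::euclidean_space \<Rightarrow> real"
  assumes "sublinear \<sigma>" "convex_on UNIV f" "\<And>x. f x \<le> \<sigma> x + w"
  shows "f (x + v) \<le> f x + \<sigma> v"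
proof (rule field_le_epsilon)
  fix e :: real assume e: "0 < e"
  define c where "c = \<bar>\<sigma> x + w - f x\<bar>"
  define s where "s = e / (e + c)"
  have c: "0 \<le> c" "\<sigma> x + w - f x \<le> c"
    by (auto simp: c_def)
  \<comment> \<open>\<open>x + v\<close> lies on the segment from \<open>x\<close> to \<open>x + v / s\<close>; the far end contributes an error of at
    most \<open>s * c\<close>.\<close>
  have s: "0 < s" "s \<le> 1" "s * c \<le> e"
    using e c by (auto simp: s_def divide_simps algebra_simps)
  have "x + v = (1 - s) *\<^sub>R x + s *\<^sub>R (x + v /\<^sub>R s)"
    using s by (simp add: algebra_simps)
  then have "f (x + v) \<le> (1 - s) * f x + s * f (x + v /\<^sub>R s)"
    using convex_onD[OF assms(2), of s x "x + v /\<^sub>R s"] s by simp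
  also have "\<dots> \<le> (1 - s) * f x + s * (\<sigma> x + \<sigma> v / s + w)"
  proof -
    have "f (x + v /\<^sub>R s) \<le> \<sigma> x + \<sigma> (v /\<^sub>R s) + w"
      using assms(3)[of "x + v /\<^sub>R s"] sublinear_add[OF assms(1), of x "v /\<^sub>R s"] by simp
    then show ?thesis
      using s by (simp add: sublinear_scale[OF assms(1)] divide_inverse mult.commute)
  qed
  also have "\<dots> = f x + \<sigma> v + s * (\<sigma> x + w - f x)"
    using s by (simp add: field_simps)
  also have "\<dots> \<le> f x + \<sigma> v + s * c"
    using s c by simp
  finally show "f (x + v) \<le> f x + \<sigma> v + e"
    using s by simp
qed

text \<open>Here \<open>f 0 = width \<sigma>\<close>, so uniqueness of the center identifies it with the apex of the descent
  paraboloid at \<open>0\<close>. A term of the infimum defining \<open>f_in \<sigma> x\<close> is this paraboloid at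
  \<open>fst (center \<sigma>) + (x - y)\<close>, plus \<open>\<sigma>\<close> of the step from there to \<open>x\<close>.\<close>
lemma tight_majorant_le_f_in:
  fixes f :: "'a::euclidean_space \<Rightarrow> real"
  assumes "sublinear \<sigma>" "smooth_fun 1 f" "convex_on UNIV f"
    and "\<And>x. \<sigma> x \<le> f x" "\<And>x. f x \<le> \<sigma> x + width \<sigma>"
  shows "f x \<le> f_in \<sigma> x"
proof (rule f_in_greatest)
  fix y
  obtain df where df: "\<And>x. GDERIV f x :> df x" "\<And>x y. norm (df x - df y) \<le> norm (x - y)"
    using assms(2) unfolding smooth_fun_def by auto
  let ?g = "df 0"
  have "f 0 \<le> width \<sigma>"
    using assms(5)[of 0] by (simp add: sublinear_zero[OF assms(1)])
  then have center: "center \<sigma> = (- ?g, f 0 - half_sq ?g)"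
    using core_of_smooth_majorant[OF df assms(4), of 0] by (intro center_unique[OF assms(1)]) auto
  have "f (x - y - ?g) \<le> f 0 + ?g \<bullet> (x - y - ?g) + half_sq (x - y - ?g)"
    using smooth_descent[of f df 1 0 "x - y - ?g"] df by simp
  also have "\<dots> = f 0 - half_sq ?g + half_sq (x - y)"
    unfolding half_sq_diff[of "x - y" ?g] by (simp add: inner_diff inner_commute half_sq_inner)
  finally have "f (x - y - ?g) \<le> f 0 - half_sq ?g + half_sq (x - y)" .
  moreover have "f x \<le> f (x - y - ?g) + \<sigma> (y + ?g)"
    using convex_growth_le_sublinear[OF assms(1,3,5), of "x - y - ?g" "y + ?g"] by simp
  ultimately show "f x \<le> snd (center \<sigma>) + \<sigma> (y - fst (center \<sigma>)) + half_sq (x - y)"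
    by (simp add: center)
qed

section \<open>Optimal smoothings at every level\<close>

lemma sup_dist_le_iff: "sup_dist f g \<le> ereal c \<longleftrightarrow> (\<forall>x. \<bar>f x - g x\<bar> \<le> c)"
  by (simp add: sup_dist_def SUP_le_iff)

text \<open>The gap bound is the form in which optimality is verified. It forces the pointwise bracket
  because \<open>F_in \<sigma>\<close> lies below every \<open>1\<close>-smooth majorant and \<open>f_in \<sigma>\<close> above every convex one of
  minimal gap.\<close>
lemma unit_tight_iff_between:
  fixes f :: "'a::euclidean_space \<Rightarrow> real"
  assumes "sublinear \<sigma>" "smooth_fun 1 f" "convex_on UNIV f"
  shows "(\<forall>x. F_in \<sigma> x \<le> f x) \<and> (\<forall>x. f x \<le> f_in \<sigma> x) \<longleftrightarrow>
    (\<forall>x. \<sigma> x \<le> f x) \<and> (\<forall>x. f x \<le> \<sigma> x + width \<sigma>)"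
proof
  assume "(\<forall>x. F_in \<sigma> x \<le> f x) \<and> (\<forall>x. f x \<le> f_in \<sigma> x)"
  then show "(\<forall>x. \<sigma> x \<le> f x) \<and> (\<forall>x. f x \<le> \<sigma> x + width \<sigma>)"
    using sigma_le_F_in[OF assms(1)] f_in_bounds(2)[OF assms(1)] by (meson order_trans)
next
  assume "(\<forall>x. \<sigma> x \<le> f x) \<and> (\<forall>x. f x \<le> \<sigma> x + width \<sigma>)"
  then show "(\<forall>x. F_in \<sigma> x \<le> f x) \<and> (\<forall>x. f x \<le> f_in \<sigma> x)"
    using smooth_majorant_bounds(1)[OF assms(1,2)] tight_majorant_le_f_in[OF assms] by blast
qed

lemma unit_rescale:
  fixes f :: "'a::euclidean_space \<Rightarrow> real"
  assumes "0 < \<beta>" "smooth_fun \<beta> f"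
  shows "smooth_fun 1 (rescale \<beta> f)"
  using smooth_rescale[OF assms(2,1)] assms(1) by simp

lemma majorant_rescale:
  assumes "sublinear \<sigma>" "0 < \<beta>"
  shows "(\<forall>x. \<sigma> x \<le> f x) \<longleftrightarrow> (\<forall>x. \<sigma> x \<le> rescale \<beta> f x)"
  using rescale_inverse_le_iff(1)[OF assms(2), of \<sigma> f] assms by (simp add: sublinear_rescale)

text \<open>Since \<open>\<sigma>\<close> vanishes at the origin, \<open>f 0\<close> is the gap there, so this one point already bounds
  \<open>sup_dist\<close> from below.\<close>
lemma width_le_smooth_majorant:
  fixes f :: "'a::euclidean_space \<Rightarrow> real"
  assumes "sublinear \<sigma>" "0 < \<beta>" "smooth_fun \<beta> f" "\<forall>x. \<sigma> x \<le> f x"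
  shows "width \<sigma> / \<beta> \<le> f 0"
proof -
  have "width \<sigma> \<le> rescale \<beta> f 0"
    using assms majorant_rescale[OF assms(1,2)]
    by (intro smooth_majorant_bounds(2) unit_rescale) auto
  then show ?thesis
    using assms(2) by (simp add: rescale_def divide_simps mult.commute)
qed

lemma rescaled_f_in:
  fixes \<sigma> :: "'a::euclidean_space \<Rightarrow> real"
  assumes "sublinear \<sigma>" "0 < \<beta>"
  defines "h \<equiv> rescale (1 / \<beta>) (f_in \<sigma>)"
  shows "smooth_fun \<beta> h" and "convex_on UNIV h"
    and "\<sigma> x \<le> h x" and "h x \<le> \<sigma> x + width \<sigma> / \<beta>"
proof -
  show "smooth_fun \<beta> h" "convex_on UNIV h"
    using smooth_rescale[OF f_in_smooth_convex(1)[OF assms(1)], of "1 / \<beta>"] assms(2)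
      convex_rescale[OF f_in_smooth_convex(2)[OF assms(1)], of "1 / \<beta>"]
    by (simp_all add: h_def)
  have "\<sigma> (\<beta> *\<^sub>R x) = \<beta> * \<sigma> x"
    using assms by (simp add: sublinear_scale)
  then show "\<sigma> x \<le> h x" "h x \<le> \<sigma> x + width \<sigma> / \<beta>"
    using f_in_bounds[OF assms(1), of "\<beta> *\<^sub>R x"] assms(2)
    by (simp_all add: h_def rescale_def field_simps)
qed

text \<open>The rescaled \<open>f_in \<sigma>\<close> competes with gap at most \<open>width \<sigma> / \<beta>\<close>, and no competitor has a
  smaller one.\<close>
lemma optimal_inner_smoothing_iff:
  fixes f :: "'a::euclidean_space \<Rightarrow> real"
  assumes "sublinear \<sigma>" "0 < \<beta>" "smooth_fun \<beta> f" "convex_on UNIV f"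
  shows "optimal_inner_smoothing \<beta> \<sigma> f \<longleftrightarrow>
    (\<forall>x. \<sigma> x \<le> f x) \<and> (\<forall>x. f x \<le> \<sigma> x + width \<sigma> / \<beta>)"
proof
  let ?h = "rescale (1 / \<beta>) (f_in \<sigma>)"
  note h = rescaled_f_in[OF assms(1,2)]
  assume opt: "optimal_inner_smoothing \<beta> \<sigma> f"
  then have le: "\<forall>x. \<sigma> x \<le> f x" and "sup_dist \<sigma> f \<le> sup_dist \<sigma> ?h"
    using h unfolding optimal_inner_smoothing_def by auto
  moreover have "sup_dist \<sigma> ?h \<le> ereal (width \<sigma> / \<beta>)"
    unfolding sup_dist_le_iff
  proof
    fix x
    show "\<bar>\<sigma> x - ?h x\<bar> \<le> width \<sigma> / \<beta>"
      using h(3,4)[of x] by linarith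
  qed
  ultimately have "sup_dist \<sigma> f \<le> ereal (width \<sigma> / \<beta>)"
    by (blast intro: order_trans)
  then have gap: "\<bar>\<sigma> x - f x\<bar> \<le> width \<sigma> / \<beta>" for x
    unfolding sup_dist_le_iff by blast
  have "f x \<le> \<sigma> x + width \<sigma> / \<beta>" for x
    using gap[of x] by linarith
  with le show "(\<forall>x. \<sigma> x \<le> f x) \<and> (\<forall>x. f x \<le> \<sigma> x + width \<sigma> / \<beta>)"
    by blast
next
  assume *: "(\<forall>x. \<sigma> x \<le> f x) \<and> (\<forall>x. f x \<le> \<sigma> x + width \<sigma> / \<beta>)"
  have f: "sup_dist \<sigma> f \<le> ereal (width \<sigma> / \<beta>)"
    unfolding sup_dist_le_iff
  proof
    fix x
    show "\<bar>\<sigma> x - f x\<bar> \<le> width \<sigma> / \<beta>"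
      using *[THEN conjunct1, rule_format, of x] *[THEN conjunct2, rule_format, of x] by linarith
  qed
  have "ereal (width \<sigma> / \<beta>) \<le> sup_dist \<sigma> g" if "smooth_fun \<beta> g" "\<forall>x. \<sigma> x \<le> g x" for g
  proof -
    have "ereal (width \<sigma> / \<beta>) \<le> ereal \<bar>\<sigma> 0 - g 0\<bar>"
      using width_le_smooth_majorant[OF assms(1,2) that] by (simp add: sublinear_zero[OF assms(1)])
    also have "\<dots> \<le> sup_dist \<sigma> g"
      unfolding sup_dist_def by (rule SUP_upper) simp
    finally show ?thesis .
  qed
  with * f assms(3,4) show "optimal_inner_smoothing \<beta> \<sigma> f"
    unfolding optimal_inner_smoothing_def by (blast intro: order_trans)
qed

lemma inner_smoothable_iff:
  assumes "sublinear \<sigma>"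
  shows "inner_smoothable l \<sigma> \<longleftrightarrow> width \<sigma> \<le> l"
proof
  assume "inner_smoothable l \<sigma>"
  then obtain f where f: "smooth_fun 1 f" "\<forall>x. \<sigma> x \<le> f x" "sup_dist f \<sigma> \<le> ereal l"
    unfolding inner_smoothable_def using zero_less_one by (metis div_by_1)
  have "\<bar>f 0 - \<sigma> 0\<bar> \<le> l"
    using f(3) unfolding sup_dist_le_iff by blast
  then show "width \<sigma> \<le> l"
    using width_le_smooth_majorant[OF assms zero_less_one f(1,2)]
    by (simp add: sublinear_zero[OF assms])
next
  assume l: "width \<sigma> \<le> l"
  show "inner_smoothable l \<sigma>"
    unfolding inner_smoothable_def
  proof (intro allI impI)
    fix \<beta> :: real assume \<beta>: "0 < \<beta>"
    let ?h = "rescale (1 / \<beta>) (f_in \<sigma>)"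
    note h = rescaled_f_in[OF assms \<beta>]
    have "width \<sigma> / \<beta> \<le> l / \<beta>"
      using l \<beta> by (simp add: divide_right_mono)
    then have "\<bar>?h x - \<sigma> x\<bar> \<le> l / \<beta>" for x
      using h(3,4)[of x] by linarith
    then have "sup_dist ?h \<sigma> \<le> ereal (l / \<beta>)"
      unfolding sup_dist_le_iff by blast
    with h show "\<exists>f. smooth_fun \<beta> f \<and> convex_on UNIV f \<and> (\<forall>x. \<sigma> x \<le> f x) \<and>
        sup_dist f \<sigma> \<le> ereal (l / \<beta>)"
      by blast
  qed
qed

theorem theorem4p3:
  fixes \<sigma> :: "'a::euclidean_space \<Rightarrow> real"
  assumes "sublinear \<sigma>"
  shows "(\<forall>l::real. inner_smoothable l \<sigma> \<longleftrightarrow> l \<ge> width \<sigma>) \<and>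
    (\<forall>\<beta>>0. \<forall>f :: 'a \<Rightarrow> real. smooth_fun \<beta> f \<and> convex_on UNIV f \<longrightarrow>
       (optimal_inner_smoothing \<beta> \<sigma> f \<longleftrightarrow>
         (\<forall>x. rescale (1 / \<beta>) (F_in \<sigma>) x \<le> f x \<and> f x \<le> rescale (1 / \<beta>) (f_in \<sigma>) x)))"
proof (intro conjI allI impI)
  fix l show "inner_smoothable l \<sigma> \<longleftrightarrow> l \<ge> width \<sigma>"
    by (rule inner_smoothable_iff[OF assms])
next
  fix \<beta> :: real and f :: "'a \<Rightarrow> real"
  assume \<beta>: "0 < \<beta>" and f: "smooth_fun \<beta> f \<and> convex_on UNIV f"
  have gap: "rescale (1 / \<beta>) (\<lambda>x. \<sigma> x + width \<sigma>) x = \<sigma> x + width \<sigma> / \<beta>" for x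
    using \<beta> by (simp add: rescale_def sublinear_scale[OF assms] field_simps)
  have "optimal_inner_smoothing \<beta> \<sigma> f \<longleftrightarrow>
      (\<forall>x. \<sigma> x \<le> f x) \<and> (\<forall>x. f x \<le> \<sigma> x + width \<sigma> / \<beta>)"
    using f by (intro optimal_inner_smoothing_iff[OF assms \<beta>]) auto
  also have "\<dots> \<longleftrightarrow> (\<forall>x. \<sigma> x \<le> rescale \<beta> f x) \<and> (\<forall>x. rescale \<beta> f x \<le> \<sigma> x + width \<sigma>)"
    using majorant_rescale[OF assms \<beta>, of f]
      rescale_inverse_le_iff(2)[OF \<beta>, of f "\<lambda>x. \<sigma> x + width \<sigma>"]
    by (simp add: gap)
  also have "\<dots> \<longleftrightarrow> (\<forall>x. F_in \<sigma> x \<le> rescale \<beta> f x) \<and> (\<forall>x. rescale \<beta> f x \<le> f_in \<sigma> x)"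
    using f \<beta> by (intro unit_tight_iff_between[OF assms, symmetric] unit_rescale convex_rescale) auto
  also have "\<dots> \<longleftrightarrow> (\<forall>x. rescale (1 / \<beta>) (F_in \<sigma>) x \<le> f x \<and> f x \<le> rescale (1 / \<beta>) (f_in \<sigma>) x)"
    by (simp add: rescale_inverse_le_iff[OF \<beta>] all_conj_distrib)
  finally show "optimal_inner_smoothing \<beta> \<sigma> f \<longleftrightarrow>
      (\<forall>x. rescale (1 / \<beta>) (F_in \<sigma>) x \<le> f x \<and> f x \<le> rescale (1 / \<beta>) (f_in \<sigma>) x)" .
qed

end
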